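(* For any instance $(G,H)$ of Directed Multicut, the optimum values of the Label-LP and of the distance LP coincide, both for the fractional relaxations and for the integral versions (all variables restricted to $\{0,1\}$).
   Context: Directed Multicut instance: directed supply graph $G=(V_G,E)$ with nonnegative edge weights $w_e$, directed simple demand graph $H$ with vertex set $V_H=\{s_1,\dots,s_k\}\subseteq V_G$ and edge set $E_H$; a feasible solution is $E'\subseteq E$ such that for every $(s_i,s_j)\in E_H$ there is no directed $s_i$-$s_j$ path in $G-E'$. Distance LP: minimize $\sum_{e\in E} w_e x_e$ subject to $\sum_{e\in p}x_e\ge 1$ for every directed path $p$ from $s_i$ to $s_j$ in $G$ with $(s_i,s_j)\in E_H$, and $x_e\ge 0$. Label-LP: let $L=\{0,1\}^k$, with $\sigma[i]$ the $i$-th bit of $\sigma\in L$ and $\sigma_1\le\sigma_2$ iff $\sigma_1[i]\le\sigma_2[i]$ for all $i$. Variables $z_{v,\sigma}$ ($v\in V_G,\sigma\in L$), $z_{e,\sigma_1\sigma_2}$ ($e\in E,\sigma_1,\sigma_2\in L$), $x_e$ ($e\in E$). Minimize $\sum_{e\in E} w_e x_e$ subject to: $\sum_{\sigma\in L} z_{v,\sigma}=1$ for all $v\in V_G$; $z_{s_i,\sigma}=0$ for all $i$ and all $\sigma$ with $\sigma[i]=0$; $z_{s_j,\sigma}=0$ for all $(s_i,s_j)\in E_H$ and all $\sigma$ with $\sigma[i]=1$; for every $e=(u,v)\in E$: $\sum_{\sigma_2\in L} z_{e,\sigma_1\sigma_2}=z_{u,\sigma_1}$ for all $\sigma_1\in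 L$, $\sum_{\sigma_1\in L} z_{e,\sigma_1\sigma_2}=z_{v,\sigma_2}$ for all $\sigma_2\in L$, and $x_e=\sum_{\sigma_1,\sigma_2\in L:\ \sigma_1\not\le\sigma_2} z_{e,\sigma_1\sigma_2}$; and $0\le z_{v,\sigma}, z_{e,\sigma_1\sigma_2}\le 1$. *)

theory Defs
  imports Complex_Main "HOL-Library.FuncSet" "Graph_Theory.Arc_Walk"
begin

text \<open>
  In Graph_Theory, \<^locale>\<open>fin_digraph\<close> admits loops and parallel arcs, whereas
  \<^locale>\<open>digraph\<close> is finite, loop-free and without parallel arcs, i.e. simple.
\<close>

locale directed_multicut = G: fin_digraph G + H: digraph H
  for G :: "('a, 'b) pre_digraph" and H :: "('a, 'c) pre_digraph" +
  fixes w :: "'b \<Rightarrow> real" and k :: nat and s :: "nat \<Rightarrow> 'a"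
  assumes weight_nonneg: "e \<in> arcs G \<Longrightarrow> 0 \<le> w e"
    and terminals_inj: "inj_on s {1..k}"
    and terminals: "verts H = s ` {1..k}"
    and terminals_in_supply: "verts H \<subseteq> verts G"

text \<open>Only the values of LP variables at indices occurring in the LP are constrained.\<close>

definition cost :: "('a, 'b) pre_digraph \<Rightarrow> ('b \<Rightarrow> real) \<Rightarrow> ('b \<Rightarrow> real) \<Rightarrow> real" where
  "cost G w x = (\<Sum>e\<in>arcs G. w e * x e)"

definition distance_lp ::
  "('a, 'b) pre_digraph \<Rightarrow> ('a, 'c) pre_digraph \<Rightarrow> ('b \<Rightarrow> real) \<Rightarrow> bool" where
  "distance_lp G H x \<longleftrightarrow>
     (\<forall>u v p. (u, v) \<in> arcs_ends H \<and> pre_digraph.apath G u p v \<longrightarrow> (\<Sum>e\<in>set p. x e) \<ge> 1) \<and>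
     (\<forall>e\<in>arcs G. x e \<ge> 0)"

definition distance_ip ::
  "('a, 'b) pre_digraph \<Rightarrow> ('a, 'c) pre_digraph \<Rightarrow> ('b \<Rightarrow> real) \<Rightarrow> bool" where
  "distance_ip G H x \<longleftrightarrow> distance_lp G H x \<and> (\<forall>e\<in>arcs G. x e \<in> {0, 1})"

type_synonym label = "nat \<Rightarrow> nat"

definition labels :: "nat \<Rightarrow> label set" where
  "labels k = {1..k} \<rightarrow>\<^sub>E {0, 1}"

definition label_le :: "nat \<Rightarrow> label \<Rightarrow> label \<Rightarrow> bool" where
  "label_le k \<sigma>\<^sub>1 \<sigma>\<^sub>2 \<longleftrightarrow> (\<forall>i\<in>{1..k}. \<sigma>\<^sub>1 i \<le> \<sigma>\<^sub>2 i)"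

type_synonym ('a, 'b) label_vars =
  "('a \<Rightarrow> label \<Rightarrow> real) \<times> ('b \<Rightarrow> label \<Rightarrow> label \<Rightarrow> real) \<times> ('b \<Rightarrow> real)"

fun label_lp ::
  "('a, 'b) pre_digraph \<Rightarrow> ('a, 'c) pre_digraph \<Rightarrow> nat \<Rightarrow> (nat \<Rightarrow> 'a) \<Rightarrow> ('a, 'b) label_vars \<Rightarrow> bool"
where
  "label_lp G H k s (zv, ze, x) \<longleftrightarrow>
     (\<forall>v\<in>verts G. (\<Sum>\<sigma>\<in>labels k. zv v \<sigma>) = 1) \<and>
     (\<forall>i\<in>{1..k}. \<forall>\<sigma>\<in>labels k. \<sigma> i = 0 \<longrightarrow> zv (s i) \<sigma> = 0) \<and>
     (\<forall>i\<in>{1..k}. \<forall>j\<in>{1..k}. (s i, s j) \<in> arcs_ends H \<longrightarrow>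
        (\<forall>\<sigma>\<in>labels k. \<sigma> i = 1 \<longrightarrow> zv (s j) \<sigma> = 0)) \<and>
     (\<forall>e\<in>arcs G.
        (\<forall>\<sigma>\<^sub>1\<in>labels k. (\<Sum>\<sigma>\<^sub>2\<in>labels k. ze e \<sigma>\<^sub>1 \<sigma>\<^sub>2) = zv (tail G e) \<sigma>\<^sub>1) \<and>
        (\<forall>\<sigma>\<^sub>2\<in>labels k. (\<Sum>\<sigma>\<^sub>1\<in>labels k. ze e \<sigma>\<^sub>1 \<sigma>\<^sub>2) = zv (head G e) \<sigma>\<^sub>2) \<and>
        x e = (\<Sum>(\<sigma>\<^sub>1, \<sigma>\<^sub>2)\<in>{(\<sigma>\<^sub>1, \<sigma>\<^sub>2) \<in> labels k \<times> labels k. \<not> label_le k \<sigma>\<^sub>1 \<sigma>\<^sub>2}. ze e \<sigma>\<^sub>1 \<sigma>\<^sub>2)) \<and>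
     (\<forall>v\<in>verts G. \<forall>\<sigma>\<in>labels k. 0 \<le> zv v \<sigma> \<and> zv v \<sigma> \<le> 1) \<and>
     (\<forall>e\<in>arcs G. \<forall>\<sigma>\<^sub>1\<in>labels k. \<forall>\<sigma>\<^sub>2\<in>labels k. 0 \<le> ze e \<sigma>\<^sub>1 \<sigma>\<^sub>2 \<and> ze e \<sigma>\<^sub>1 \<sigma>\<^sub>2 \<le> 1)"

fun label_ip ::
  "('a, 'b) pre_digraph \<Rightarrow> ('a, 'c) pre_digraph \<Rightarrow> nat \<Rightarrow> (nat \<Rightarrow> 'a) \<Rightarrow> ('a, 'b) label_vars \<Rightarrow> bool"
where
  "label_ip G H k s (zv, ze, x) \<longleftrightarrow> label_lp G H k s (zv, ze, x) \<and>
     (\<forall>v\<in>verts G. \<forall>\<sigma>\<in>labels k. zv v \<sigma> \<in> {0, 1}) \<and>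
     (\<forall>e\<in>arcs G. \<forall>\<sigma>\<^sub>1\<in>labels k. \<forall>\<sigma>\<^sub>2\<in>labels k. ze e \<sigma>\<^sub>1 \<sigma>\<^sub>2 \<in> {0, 1}) \<and>
     (\<forall>e\<in>arcs G. x e \<in> {0, 1})"

fun label_cost :: "('a, 'b) pre_digraph \<Rightarrow> ('b \<Rightarrow> real) \<Rightarrow> ('a, 'b) label_vars \<Rightarrow> real" where
  "label_cost G w (zv, ze, x) = cost G w x"

definition is_opt_value :: "('y \<Rightarrow> bool) \<Rightarrow> ('y \<Rightarrow> real) \<Rightarrow> real \<Rightarrow> bool" where
  "is_opt_value feasible c m \<longleftrightarrow> (\<exists>y. is_arg_min c feasible y \<and> c y = m)"

end

theory Submission
  imports Defs "HOL-Probability.Probability_Measure" "Graph_Theory.Shortest_Path"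
begin

text \<open>
  If \<open>(zv, ze, x)\<close> is feasible for the Label-LP, then for each terminal \<open>s\<^sub>i\<close> the potential
  \<open>f\<^sub>i v = (\<Sum>\<sigma> with \<sigma> i = 1. zv v \<sigma>)\<close> drops by at most \<open>x e\<close> along an arc \<open>e\<close>, and it drops from 1
  to 0 between the ends of a demand arc starting in \<open>s\<^sub>i\<close>; hence \<open>x\<close> is feasible for the distance LP.

  Conversely, let \<open>x\<close> be feasible for the distance LP and draw \<open>\<theta>\<close> uniformly from \<open>[0, 1)\<close>. Give \<open>v\<close>
  the random label whose \<open>i\<close>-th bit says whether \<open>v\<close> is within distance \<open>\<theta>\<close> of \<open>s\<^sub>i\<close>. Using the same
  \<open>\<theta>\<close> at both ends of an arc would be too expensive, since the violations for different \<open>i\<close> add up.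
  Instead, \<open>\<theta>\<close> at the tail of \<open>e\<close> is coupled with \<open>\<theta> + x e\<close> modulo 1 at the head: the marginals are
  unchanged, and by the triangle inequality the labels are ordered unless \<open>\<theta> + x e\<close> wraps around,
  which has probability at most \<open>x e\<close>. For integral \<open>x\<close> it suffices to take the labels at \<open>\<theta> = 0\<close>.

  The optimum of the distance LP is attained because capping at 1 reduces the problem to a
  compact set; by the two translations it is then also the optimum of the Label-LP.
\<close>

section \<open>Optimal values\<close>

lemma is_opt_value_transfer:
  assumes opt: "is_opt_value P f m"
    and below: "\<And>z. Q z \<Longrightarrow> \<exists>y. P y \<and> f y \<le> g z"
    and above: "\<And>y. P y \<Longrightarrow> \<exists>z. Q z \<and> g z \<le> f y"
  shows "is_opt_value Q g m"
proof -
  obtain y where y: "P y" "f y = m" and min: "\<And>y'. P y' \<Longrightarrow> m \<le> f y'"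
    using opt unfolding is_opt_value_def is_arg_min_linorder by blast
  have lower: "m \<le> g z" if "Q z" for z
    using below[OF that] min order_trans by blast
  obtain z where z: "Q z" "g z \<le> m"
    using above y by blast
  with lower have "g z = m" by (simp add: antisym)
  then show ?thesis
    using z lower unfolding is_opt_value_def is_arg_min_linorder by blast
qed

lemma compact_imp_ex_opt_value:
  fixes f :: "'a::topological_space \<Rightarrow> real"
  assumes "compact K" "K \<noteq> {}" "continuous_on K f"
  shows "\<exists>m. is_opt_value (\<lambda>x. x \<in> K) f m"
  using continuous_attains_inf[OF assms] unfolding is_opt_value_def is_arg_min_linorder by blast

lemma compact_PiE_UNIV:
  fixes S :: "'i \<Rightarrow> 'a::topological_space set"
  assumes "\<And>i. compact (S i)"
  shows "compact (PiE UNIV S)"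
proof -
  have "compactin (product_topology (\<lambda>_. euclidean) UNIV) (PiE UNIV S)"
    using assms by (simp add: compactin_PiE)
  then show ?thesis by (simp add: euclidean_product_topology)
qed

section \<open>The distance LP\<close>

lemma (in wf_digraph) awalk_cost_apath: "apath u p v \<Longrightarrow> awalk_cost x p = sum x (set p)"
  unfolding awalk_cost_def apath_def
  using distinct_verts_imp_distinct by (auto simp: sum_list_distinct_conv_sum_set)

lemma (in wf_digraph) potential_drop_le_\<mu>:
  fixes f :: "'a \<Rightarrow> real"
  assumes drop: "\<And>e. e \<in> arcs G \<Longrightarrow> f (tail G e) - f (head G e) \<le> x e"
  shows "f u - f v \<le> \<mu> x u v"
proof -
  have "f u - f v \<le> awalk_cost x p" if "awalk u p v" for p
    using that
  proof (induction p arbitrary: u)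
    case Nil
    then show ?case by (simp add: awalk_Nil_iff)
  next
    case (Cons e p)
    then have "f (head G e) - f v \<le> awalk_cost x p" "u = tail G e" "e \<in> arcs G"
      by (auto simp: awalk_Cons_iff)
    with drop[of e] show ?case by simp
  qed
  then show ?thesis unfolding \<mu>_def by (auto intro!: INF_greatest)
qed

lemma (in fin_digraph) le_\<mu>_iff_apath:
  assumes nonneg: "\<And>e. e \<in> arcs G \<Longrightarrow> 0 \<le> x e"
  shows "ereal c \<le> \<mu> x u v \<longleftrightarrow> (\<forall>p. apath u p v \<longrightarrow> c \<le> sum x (set p))"
proof
  assume "ereal c \<le> \<mu> x u v"
  then show "\<forall>p. apath u p v \<longrightarrow> c \<le> sum x (set p)"
    using min_cost_le_walk_cost[of u _ v x] awalkI_apath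
    by (metis awalk_cost_apath ereal_less_eq(3) order_trans)
next
  assume paths: "\<forall>p. apath u p v \<longrightarrow> c \<le> sum x (set p)"
  show "ereal c \<le> \<mu> x u v"
  proof (cases "u \<rightarrow>\<^sup>* v")
    case True
    then obtain p where "apath u p v" "\<mu> x u v = awalk_cost x p"
      using min_cost_awalk nonneg by blast
    with paths show ?thesis by (simp add: awalk_cost_apath)
  qed (simp add: shortest_path_inf)
qed

lemma (in fin_digraph) distance_lp_iff_\<mu>:
  "distance_lp G H x \<longleftrightarrow>
     (\<forall>e\<in>arcs G. 0 \<le> x e) \<and> (\<forall>(u, v)\<in>arcs_ends H. 1 \<le> \<mu> x u v)"
proof (cases "\<forall>e\<in>arcs G. 0 \<le> x e")
  case True
  then show ?thesis
    using le_\<mu>_iff_apath[of x 1] unfolding distance_lp_def one_ereal_def by auto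
qed (auto simp: distance_lp_def)

lemma (in wf_digraph) distance_lp_cong:
  assumes "\<And>e. e \<in> arcs G \<Longrightarrow> x e = y e"
  shows "distance_lp G H x \<longleftrightarrow> distance_lp G H y"
proof -
  have "sum x (set p) = sum y (set p)" if "apath u p v" for u p v
    using that assms by (intro sum.cong) (auto simp: apath_def)
  then show ?thesis using assms unfolding distance_lp_def by metis
qed

lemma (in wf_digraph) distance_lp_cap:
  assumes "distance_lp G H x"
  shows "distance_lp G H (\<lambda>e. min 1 (x e))"
  unfolding distance_lp_def
proof (intro conjI allI impI ballI)
  have nonneg: "0 \<le> x e" if "e \<in> arcs G" for e
    using assms that by (simp add: distance_lp_def)
  then show "0 \<le> min 1 (x e)" if "e \<in> arcs G" for e
    using that by simp
  fix u v p assume p: "(u, v) \<in> arcs_ends H \<and> apath u p v"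
  then have arcs: "set p \<subseteq> arcs G" by (auto simp: apath_def)
  show "1 \<le> (\<Sum>e\<in>set p. min 1 (x e))"
  proof (cases "\<exists>e\<in>set p. 1 \<le> x e")
    case True
    then obtain e where e: "e \<in> set p" "1 \<le> x e" by blast
    then have "min 1 (x e) \<le> (\<Sum>e\<in>set p. min 1 (x e))"
      using arcs nonneg by (intro member_le_sum) auto
    with e show ?thesis by simp
  next
    case False
    then have "(\<Sum>e\<in>set p. min 1 (x e)) = sum x (set p)" by (intro sum.cong) auto
    then show ?thesis using assms p by (auto simp: distance_lp_def)
  qed
qed

lemma (in wf_digraph) distance_lp_one:
  assumes "loopfree_digraph H"
  shows "distance_lp G H (\<lambda>_. 1)"
  unfolding distance_lp_def
proof (intro conjI allI impI ballI)
  fix u v p assume "(u, v) \<in> arcs_ends H \<and> apath u p v"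
  then have "p \<noteq> []"
    using loopfree_digraph.adj_not_same[OF assms] by (auto simp: apath_Nil_iff)
  then show "1 \<le> (\<Sum>e\<in>set p. 1 :: real)" by (simp add: Suc_le_eq card_gt_0_iff)
qed simp

lemma closed_distance_lp: "closed {x. distance_lp G H x}"
  unfolding distance_lp_def Ball_def
  by (intro closed_Collect_conj closed_Collect_all closed_Collect_imp closed_Collect_le
      open_Collect_const continuous_on_sum continuous_on_const) simp_all

lemma cost_cong: "(\<And>e. e \<in> arcs G \<Longrightarrow> x e = y e) \<Longrightarrow> cost G w x = cost G w y"
  unfolding cost_def by (intro sum.cong) auto

lemma continuous_on_cost: "continuous_on A (cost G w)"
  unfolding cost_def
  by (intro continuous_intros continuous_on_subset[of UNIV "\<lambda>x. x _" A]) simp_all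

context directed_multicut
begin

lemma cost_mono: "(\<And>e. e \<in> arcs G \<Longrightarrow> x e \<le> y e) \<Longrightarrow> cost G w x \<le> cost G w y"
  unfolding cost_def by (intro sum_mono mult_left_mono weight_nonneg)

lemma ex_opt_value_distance_lp_on:
  assumes "compact D" "1 \<in> D"
  shows "\<exists>m. is_opt_value (\<lambda>x. distance_lp G H x \<and> (\<forall>e\<in>arcs G. x e \<in> D)) (cost G w) m"
proof -
  define K where "K = PiE UNIV (\<lambda>e. if e \<in> arcs G then D else {0}) \<inter> {x. distance_lp G H x}"
  define trunc :: "('b \<Rightarrow> real) \<Rightarrow> 'b \<Rightarrow> real"
    where "trunc x = (\<lambda>e. if e \<in> arcs G then x e else 0)" for x
  have trunc: "trunc x \<in> K" "cost G w (trunc x) = cost G w x"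
    if "distance_lp G H x" "\<forall>e\<in>arcs G. x e \<in> D" for x
  proof -
    have "distance_lp G H (trunc x) \<longleftrightarrow> distance_lp G H x"
      by (rule G.distance_lp_cong) (simp add: trunc_def)
    then show "trunc x \<in> K" using that by (auto simp: K_def trunc_def)
    show "cost G w (trunc x) = cost G w x"
      by (rule cost_cong) (simp add: trunc_def)
  qed
  have K_feasible: "distance_lp G H x \<and> (\<forall>e\<in>arcs G. x e \<in> D)" if "x \<in> K" for x
    using that by (auto simp: K_def PiE_iff split: if_splits)
  have "compact K"
    unfolding K_def using assms
    by (intro compact_Int_closed compact_PiE_UNIV closed_distance_lp) simp
  moreover have "trunc (\<lambda>_. 1) \<in> K"
    using assms H.loopfree_digraph_axioms by (intro trunc G.distance_lp_one) simp_all
  ultimately obtain m where "is_opt_value (\<lambda>x. x \<in> K) (cost G w) m"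
    using compact_imp_ex_opt_value[OF _ _ continuous_on_cost] by blast
  then have "is_opt_value (\<lambda>x. distance_lp G H x \<and> (\<forall>e\<in>arcs G. x e \<in> D)) (cost G w) m"
    by (rule is_opt_value_transfer) (use trunc K_feasible order_refl in metis)+
  then show ?thesis ..
qed

lemma ex_opt_value_distance_ip: "\<exists>m. is_opt_value (distance_ip G H) (cost G w) m"
  using ex_opt_value_distance_lp_on[of "{0, 1}"]
  by (simp add: finite_imp_compact distance_ip_def[abs_def])

lemma ex_opt_value_distance_lp: "\<exists>m. is_opt_value (distance_lp G H) (cost G w) m"
proof -
  obtain m where
    "is_opt_value (\<lambda>x. distance_lp G H x \<and> (\<forall>e\<in>arcs G. x e \<in> {0..1})) (cost G w) m"
    using ex_opt_value_distance_lp_on[of "{0..1}"] by auto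
  then have "is_opt_value (distance_lp G H) (cost G w) m"
  proof (rule is_opt_value_transfer)
    fix x assume x: "distance_lp G H x"
    have "distance_lp G H (\<lambda>e. min 1 (x e))"
      using x by (rule G.distance_lp_cap)
    moreover have "\<forall>e\<in>arcs G. min 1 (x e) \<in> {0..1}"
      using x by (auto simp: distance_lp_def)
    moreover have "cost G w (\<lambda>e. min 1 (x e)) \<le> cost G w x"
      by (rule cost_mono) simp
    ultimately show "\<exists>y. (distance_lp G H y \<and> (\<forall>e\<in>arcs G. y e \<in> {0..1})) \<and>
        cost G w y \<le> cost G w x" by blast
  qed blast
  then show ?thesis ..
qed

end

section \<open>From label solutions to distance solutions\<close>

lemma finite_labels: "finite (labels k)"
  unfolding labels_def by (intro finite_PiE) auto

lemma labels_cases: "\<sigma> \<in> labels k \<Longrightarrow> i \<in> {1..k} \<Longrightarrow> \<sigma> i = 0 \<or> \<sigma> i = 1"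
  by (auto simp: labels_def PiE_iff)

definition violations :: "nat \<Rightarrow> (label \<times> label) set" where
  "violations k = {(\<sigma>\<^sub>1, \<sigma>\<^sub>2) \<in> labels k \<times> labels k. \<not> label_le k \<sigma>\<^sub>1 \<sigma>\<^sub>2}"

lemma finite_violations: "finite (violations k)"
  unfolding violations_def
  by (rule finite_subset[of _ "labels k \<times> labels k"]) (auto simp: finite_labels)

definition bit_mass :: "nat \<Rightarrow> ('a \<Rightarrow> label \<Rightarrow> real) \<Rightarrow> nat \<Rightarrow> 'a \<Rightarrow> real" where
  "bit_mass k zv i v = (\<Sum>\<sigma> | \<sigma> \<in> labels k \<and> \<sigma> i = 1. zv v \<sigma>)"

lemma bit_mass_drop_le:
  assumes lp: "label_lp G H k s (zv, ze, x)" and e: "e \<in> arcs G" and i: "i \<in> {1..k}"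
  shows "bit_mass k zv i (tail G e) - bit_mass k zv i (head G e) \<le> x e"
proof -
  let ?L = "labels k" and ?S = "{\<sigma>. \<sigma> \<in> labels k \<and> \<sigma> i = 1}"
  note fin = finite_labels[of k]
  have nonneg: "0 \<le> ze e \<sigma>\<^sub>1 \<sigma>\<^sub>2" if "\<sigma>\<^sub>1 \<in> ?L" "\<sigma>\<^sub>2 \<in> ?L" for \<sigma>\<^sub>1 \<sigma>\<^sub>2
    using lp e that by simp
  have marginals: "zv (tail G e) \<sigma> = (\<Sum>\<sigma>\<^sub>2\<in>?L. ze e \<sigma> \<sigma>\<^sub>2)"
      "zv (head G e) \<sigma> = (\<Sum>\<sigma>\<^sub>1\<in>?L. ze e \<sigma>\<^sub>1 \<sigma>)" if "\<sigma> \<in> ?L" for \<sigma>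
    using lp e that by simp_all
  have tail: "bit_mass k zv i (tail G e) = (\<Sum>(\<sigma>\<^sub>1, \<sigma>\<^sub>2)\<in>?S \<times> ?L. ze e \<sigma>\<^sub>1 \<sigma>\<^sub>2)"
    by (simp add: bit_mass_def marginals sum.cartesian_product)
  have head: "bit_mass k zv i (head G e) = (\<Sum>(\<sigma>\<^sub>1, \<sigma>\<^sub>2)\<in>?L \<times> ?S. ze e \<sigma>\<^sub>1 \<sigma>\<^sub>2)"
    unfolding sum.cartesian_product[symmetric] by (subst sum.swap) (simp add: bit_mass_def marginals)
  have crossing: "?S \<times> (?L - ?S) \<subseteq> violations k"
  proof (rule subrelI)
    fix \<sigma>\<^sub>1 \<sigma>\<^sub>2 assume \<sigma>: "(\<sigma>\<^sub>1, \<sigma>\<^sub>2) \<in> ?S \<times> (?L - ?S)"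
    then have "\<sigma>\<^sub>2 i = 0" using labels_cases[OF _ i] by blast
    then have "\<not> \<sigma>\<^sub>1 i \<le> \<sigma>\<^sub>2 i" using \<sigma> by simp
    then show "(\<sigma>\<^sub>1, \<sigma>\<^sub>2) \<in> violations k"
      using \<sigma> i unfolding violations_def label_le_def by blast
  qed
  have "?S \<times> ?L = ?S \<times> ?S \<union> ?S \<times> (?L - ?S)" by auto
  then have "bit_mass k zv i (tail G e) =
      (\<Sum>(\<sigma>\<^sub>1, \<sigma>\<^sub>2)\<in>?S \<times> ?S. ze e \<sigma>\<^sub>1 \<sigma>\<^sub>2) + (\<Sum>(\<sigma>\<^sub>1, \<sigma>\<^sub>2)\<in>?S \<times> (?L - ?S). ze e \<sigma>\<^sub>1 \<sigma>\<^sub>2)"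
    unfolding tail using fin by (simp only:) (rule sum.union_disjoint; auto)
  also have "(\<Sum>(\<sigma>\<^sub>1, \<sigma>\<^sub>2)\<in>?S \<times> ?S. ze e \<sigma>\<^sub>1 \<sigma>\<^sub>2) \<le> bit_mass k zv i (head G e)"
    unfolding head using fin nonneg by (intro sum_mono2) auto
  also have "(\<Sum>(\<sigma>\<^sub>1, \<sigma>\<^sub>2)\<in>?S \<times> (?L - ?S). ze e \<sigma>\<^sub>1 \<sigma>\<^sub>2) \<le> (\<Sum>(\<sigma>\<^sub>1, \<sigma>\<^sub>2)\<in>violations k. ze e \<sigma>\<^sub>1 \<sigma>\<^sub>2)"
    using crossing nonneg by (intro sum_mono2 finite_violations) (auto simp: violations_def)
  also have "\<dots> = x e" using lp e by (simp add: violations_def)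
  finally show ?thesis by simp
qed

lemma bit_mass_source:
  assumes lp: "label_lp G H k s (zv, ze, x)" and i: "i \<in> {1..k}" and "s i \<in> verts G"
  shows "bit_mass k zv i (s i) = 1"
proof -
  have "zv (s i) \<sigma> = 0" if "\<sigma> \<in> labels k" "\<sigma> i \<noteq> 1" for \<sigma>
    using lp i that labels_cases[OF that(1) i] by simp
  then have "bit_mass k zv i (s i) = (\<Sum>\<sigma>\<in>labels k. zv (s i) \<sigma>)"
    unfolding bit_mass_def by (intro sum.mono_neutral_left finite_labels) auto
  with lp \<open>s i \<in> verts G\<close> show ?thesis by simp
qed

lemma bit_mass_demand:
  assumes "label_lp G H k s (zv, ze, x)" "i \<in> {1..k}" "j \<in> {1..k}" "(s i, s j) \<in> arcs_ends H"
  shows "bit_mass k zv i (s j) = 0"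
  unfolding bit_mass_def using assms by (intro sum.neutral) auto

lemma label_lp_nonneg:
  assumes "label_lp G H k s (zv, ze, x)" "e \<in> arcs G"
  shows "0 \<le> x e"
  using assms by (auto intro!: sum_nonneg)

context directed_multicut
begin

lemma terminal_in_verts: "i \<in> {1..k} \<Longrightarrow> s i \<in> verts G"
  using terminals terminals_in_supply by auto

lemma demand_terminals:
  assumes "(u, v) \<in> arcs_ends H"
  obtains i j where "i \<in> {1..k}" "j \<in> {1..k}" "u = s i" "v = s j"
  using H.adj_in_verts[OF assms] terminals by auto

lemma label_lp_imp_distance_lp:
  assumes lp: "label_lp G H k s (zv, ze, x)"
  shows "distance_lp G H x"
proof -
  have "1 \<le> G.\<mu> x u v" if uv: "(u, v) \<in> arcs_ends H" for u v
  proof -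
    obtain i j where ij: "i \<in> {1..k}" "j \<in> {1..k}" and [simp]: "u = s i" "v = s j"
      using uv by (rule demand_terminals)
    have "bit_mass k zv i u - bit_mass k zv i v \<le> G.\<mu> x u v"
      using bit_mass_drop_le[OF lp _ ij(1)] by (rule G.potential_drop_le_\<mu>)
    moreover have "bit_mass k zv i u = 1"
      using bit_mass_source[OF lp ij(1)] terminal_in_verts[OF ij(1)] by simp
    moreover have "bit_mass k zv i v = 0"
      using bit_mass_demand[OF lp ij] uv by simp
    ultimately show ?thesis by (simp add: one_ereal_def)
  qed
  with label_lp_nonneg[OF lp] show ?thesis by (auto simp: G.distance_lp_iff_\<mu>)
qed

lemma label_ip_imp_distance_ip: "label_ip G H k s (zv, ze, x) \<Longrightarrow> distance_ip G H x"
  using label_lp_imp_distance_lp by (auto simp: distance_ip_def simp del: label_lp.simps)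

end

section \<open>Label solutions from couplings\<close>

lemma pred_count_space_pair:
  assumes "countable A" "countable B"
    and "X \<in> measurable M (count_space A)" "Y \<in> measurable M (count_space B)"
  shows "Measurable.pred M (\<lambda>\<omega>. P (X \<omega>) (Y \<omega>))"
proof -
  have "(\<lambda>\<omega>. (X \<omega>, Y \<omega>)) \<in> measurable M (count_space (A \<times> B))"
    using measurable_Pair[OF assms(3,4)] by (simp add: pair_measure_countable assms(1,2))
  from measurable_compose[OF this, of "case_prod P" "count_space UNIV"] show ?thesis by simp
qed

lemma measure_Collect_measure_preserving:
  assumes T: "T \<in> measurable M M" and "distr M M T = M" and P: "Measurable.pred M P"
  shows "measure M {\<omega> \<in> space M. P (T \<omega>)} = measure M {\<omega> \<in> space M. P \<omega>}"
proof -
  have "T -` {\<omega> \<in> space M. P \<omega>} \<inter> space M = {\<omega> \<in> space M. P (T \<omega>)}"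
    using measurable_space[OF T] by auto
  then have "measure (distr M M T) {\<omega> \<in> space M. P \<omega>} = measure M {\<omega> \<in> space M. P (T \<omega>)}"
    using T P by (simp add: measure_distr pred_def)
  with \<open>distr M M T = M\<close> show ?thesis by simp
qed

lemma (in prob_space) prob_eq_sum_count_space_pair:
  assumes "finite A" "finite B"
    and X: "X \<in> measurable M (count_space A)" and Y: "Y \<in> measurable M (count_space B)"
  shows "\<P>(\<omega> in M. P (X \<omega>) (Y \<omega>)) =
    (\<Sum>(a, b)\<in>{(a, b) \<in> A \<times> B. P a b}. \<P>(\<omega> in M. X \<omega> = a \<and> Y \<omega> = b))"
proof -
  have events: "{\<omega> \<in> space M. Q (X \<omega>) (Y \<omega>)} \<in> events" for Q
    using pred_count_space_pair[OF _ _ X Y, of Q] assms(1,2) by (simp add: pred_def countable_finite)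
  have "finite {(a, b) \<in> A \<times> B. P a b}"
    by (rule finite_subset[of _ "A \<times> B"]) (use assms(1,2) in auto)
  then have "\<P>(\<omega> in M. P (X \<omega>) (Y \<omega>)) =
      (\<Sum>c\<in>{(a, b) \<in> A \<times> B. P a b}. \<P>(\<omega> in M. X \<omega> = fst c \<and> Y \<omega> = snd c))"
    using measurable_space[OF X] measurable_space[OF Y] by (intro prob_sum events) auto
  then show ?thesis by (simp add: case_prod_unfold)
qed

lemma (in prob_space) sum_prob_count_space:
  assumes "finite A" "X \<in> measurable M (count_space A)" "Measurable.pred M P"
  shows "(\<Sum>a\<in>A. \<P>(\<omega> in M. P \<omega> \<and> X \<omega> = a)) = \<P>(\<omega> in M. P \<omega>)"
proof (rule prob_sum[symmetric])
  show "{\<omega> \<in> space M. P \<omega>} \<in> events" using assms(3) by (simp add: pred_def)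
  have "Measurable.pred M (\<lambda>\<omega>. X \<omega> = a)" for a
    using assms(2) by (rule measurable_compose) simp
  with assms(3) show "{\<omega> \<in> space M. P \<omega> \<and> X \<omega> = a} \<in> events" for a
    by measurable
qed (use assms(1) measurable_space[OF assms(2)] in auto)

text \<open>
  The head of \<open>e\<close> reads its label at \<open>T e \<omega>\<close> and the tail at \<open>\<omega>\<close>; if \<open>T e\<close> preserves \<open>M\<close>, this is a
  coupling of the label distributions of the two ends.
\<close>

definition coupling_vars ::
  "'o measure \<Rightarrow> ('a, 'b) pre_digraph \<Rightarrow> nat \<Rightarrow> ('a \<Rightarrow> 'o \<Rightarrow> label) \<Rightarrow> ('b \<Rightarrow> 'o \<Rightarrow> 'o) \<Rightarrow>
    ('a, 'b) label_vars" where
  "coupling_vars M G k X T =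
    ((\<lambda>v \<sigma>. \<P>(\<omega> in M. X v \<omega> = \<sigma>)),
     (\<lambda>e \<sigma>\<^sub>1 \<sigma>\<^sub>2. \<P>(\<omega> in M. X (tail G e) \<omega> = \<sigma>\<^sub>1 \<and> X (head G e) (T e \<omega>) = \<sigma>\<^sub>2)),
     (\<lambda>e. \<P>(\<omega> in M. \<not> label_le k (X (tail G e) \<omega>) (X (head G e) (T e \<omega>)))))"

lemma (in prob_space) label_lp_coupling_vars:
  fixes X :: "'v \<Rightarrow> 'a \<Rightarrow> label" and T :: "'e \<Rightarrow> 'a \<Rightarrow> 'a"
  assumes X: "\<And>v. X v \<in> measurable M (count_space (labels k))"
    and T: "\<And>e. T e \<in> measurable M M" and T_preserves: "\<And>e. distr M M (T e) = M"
    and source: "\<And>i \<omega>. i \<in> {1..k} \<Longrightarrow> \<omega> \<in> space M \<Longrightarrow> X (s i) \<omega> i = 1"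
    and demand: "\<And>i j \<omega>. i \<in> {1..k} \<Longrightarrow> j \<in> {1..k} \<Longrightarrow> (s i, s j) \<in> arcs_ends H \<Longrightarrow>
        \<omega> \<in> space M \<Longrightarrow> X (s j) \<omega> i = 0"
  shows "label_lp G H k s (coupling_vars M G k X T)"
proof -
  note fin = finite_labels[of k]
  have XT: "(\<lambda>\<omega>. X v (T e \<omega>)) \<in> measurable M (count_space (labels k))" for v e
    using T X by (rule measurable_compose)
  have pred_X: "Measurable.pred M (\<lambda>\<omega>. X v \<omega> = \<sigma>)" for v \<sigma>
    using X by (rule measurable_compose) simp
  have pred_XT: "Measurable.pred M (\<lambda>\<omega>. X v (T e \<omega>) = \<sigma>)" for v e \<sigma>
    using XT by (rule measurable_compose) simp
  show ?thesis
    unfolding coupling_vars_def label_lp.simps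
  proof (intro conjI ballI impI prob_le_1 measure_nonneg)
    show "(\<Sum>\<sigma>\<in>labels k. \<P>(\<omega> in M. X v \<omega> = \<sigma>)) = 1" for v
      using sum_prob_count_space[OF fin X, of "\<lambda>_. True"] prob_space by simp
  next
    fix i and \<sigma> :: label assume "i \<in> {1..k}" "\<sigma> i = 0"
    then have "{\<omega> \<in> space M. X (s i) \<omega> = \<sigma>} = {}" using source by fastforce
    then show "\<P>(\<omega> in M. X (s i) \<omega> = \<sigma>) = 0" by (simp only: measure_empty)
  next
    fix i j and \<sigma> :: label
    assume "i \<in> {1..k}" "j \<in> {1..k}" "(s i, s j) \<in> arcs_ends H" "\<sigma> i = 1"
    then have "{\<omega> \<in> space M. X (s j) \<omega> = \<sigma>} = {}" using demand by fastforce
    then show "\<P>(\<omega> in M. X (s j) \<omega> = \<sigma>) = 0" by (simp only: measure_empty)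
  next
    fix e \<sigma>
    show "(\<Sum>\<sigma>\<^sub>2\<in>labels k. \<P>(\<omega> in M. X (tail G e) \<omega> = \<sigma> \<and> X (head G e) (T e \<omega>) = \<sigma>\<^sub>2))
        = \<P>(\<omega> in M. X (tail G e) \<omega> = \<sigma>)"
      using fin XT pred_X by (rule sum_prob_count_space)
    have "(\<Sum>\<sigma>\<^sub>1\<in>labels k. \<P>(\<omega> in M. X (tail G e) \<omega> = \<sigma>\<^sub>1 \<and> X (head G e) (T e \<omega>) = \<sigma>))
        = \<P>(\<omega> in M. X (head G e) (T e \<omega>) = \<sigma>)"
      using sum_prob_count_space[OF fin X pred_XT] by (simp add: conj_commute)
    also have "\<dots> = \<P>(\<omega> in M. X (head G e) \<omega> = \<sigma>)"
      using T T_preserves pred_X by (rule measure_Collect_measure_preserving)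
    finally show "(\<Sum>\<sigma>\<^sub>1\<in>labels k. \<P>(\<omega> in M. X (tail G e) \<omega> = \<sigma>\<^sub>1 \<and> X (head G e) (T e \<omega>) = \<sigma>))
        = \<P>(\<omega> in M. X (head G e) \<omega> = \<sigma>)" .
  qed (rule prob_eq_sum_count_space_pair[OF fin fin X XT])
qed

section \<open>The uniform measure on the unit interval\<close>

definition unit_interval :: "real measure" where
  "unit_interval = restrict_space lborel {0..<1}"

lemma space_unit_interval [simp]: "space unit_interval = {0..<1}"
  by (simp add: unit_interval_def space_restrict_space)

lemma emeasure_unit_interval: "A \<subseteq> {0..<1} \<Longrightarrow> emeasure unit_interval A = emeasure lborel A"
  by (simp add: unit_interval_def emeasure_restrict_space)

lemma prob_space_unit_interval: "prob_space unit_interval"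
  by (rule prob_spaceI) (simp add: emeasure_unit_interval)

lemma measurable_unit_intervalI: "f \<in> measurable borel N \<Longrightarrow> f \<in> measurable unit_interval N"
  unfolding unit_interval_def by (intro measurable_restrict_space1) simp

lemma emeasure_lborel_translate:
  fixes c :: "'a::euclidean_space"
  assumes "A \<in> sets borel"
  shows "emeasure lborel {x. c + x \<in> A} = emeasure lborel A"
proof -
  have "emeasure lborel A = emeasure (distr lborel borel ((+) c)) A"
    by (simp add: lborel_distr_plus)
  also have "\<dots> = emeasure lborel ((+) c -` A)"
    using assms by (simp add: emeasure_distr)
  finally show ?thesis by (simp add: vimage_def)
qed

lemma borel_measurable_frac [measurable]: "(frac :: real \<Rightarrow> real) \<in> borel_measurable borel"
  unfolding frac_def[abs_def] by measurable

lemma measurable_frac_add: "(\<lambda>\<theta>. frac (\<theta> + a)) \<in> measurable unit_interval unit_interval"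
proof -
  have "(\<lambda>\<theta>. frac (\<theta> + a)) \<in> measurable unit_interval lborel"
    by (rule measurable_unit_intervalI) simp
  then show ?thesis
    unfolding unit_interval_def by (intro measurable_restrict_space2) (auto simp: frac_lt_1)
qed

lemma distr_frac_add: "distr unit_interval unit_interval (\<lambda>\<theta>. frac (\<theta> + a)) = unit_interval"
proof (rule measure_eqI)
  fix A assume "A \<in> sets (distr unit_interval unit_interval (\<lambda>\<theta>. frac (\<theta> + a)))"
  then have A: "A \<in> sets unit_interval" "A \<subseteq> {0..<1}" "A \<in> sets borel"
    by (auto simp: unit_interval_def sets_restrict_space)
  define b where "b = frac a"
  have b: "0 \<le> b" "b < 1" by (simp_all add: b_def frac_lt_1)
  have frac: "frac (\<theta> + a) = (if \<theta> + b < 1 then \<theta> + b else \<theta> + b - 1)"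
    if "\<theta> \<in> {0..<1}" for \<theta>
    using that by (simp add: frac_add b_def frac_eq)
  have "(\<lambda>\<theta>. frac (\<theta> + a)) -` A \<inter> {0..<1} =
      {\<theta>. b + \<theta> \<in> A \<inter> {b..<1}} \<union> {\<theta>. (b - 1) + \<theta> \<in> A \<inter> {0..<b}}"
    using A(2) b by (auto simp: frac algebra_simps split: if_splits)
  moreover have "emeasure (distr unit_interval unit_interval (\<lambda>\<theta>. frac (\<theta> + a))) A =
      emeasure lborel ((\<lambda>\<theta>. frac (\<theta> + a)) -` A \<inter> {0..<1})"
    using A by (simp add: emeasure_distr measurable_frac_add emeasure_unit_interval)
  ultimately have "emeasure (distr unit_interval unit_interval (\<lambda>\<theta>. frac (\<theta> + a))) A =
      emeasure lborel ({\<theta>. b + \<theta> \<in> A \<inter> {b..<1}} \<union> {\<theta>. (b - 1) + \<theta> \<in> A \<inter> {0..<b}})"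
    by simp
  also have "\<dots> = emeasure lborel {\<theta>. b + \<theta> \<in> A \<inter> {b..<1}} +
      emeasure lborel {\<theta>. (b - 1) + \<theta> \<in> A \<inter> {0..<b}}"
    using A by (intro plus_emeasure[symmetric]) auto
  also have "\<dots> = emeasure lborel (A \<inter> {b..<1}) + emeasure lborel (A \<inter> {0..<b})"
    using A by (subst (1 2) emeasure_lborel_translate) auto
  also have "\<dots> = emeasure lborel (A \<inter> {b..<1} \<union> A \<inter> {0..<b})"
    using A by (intro plus_emeasure) auto
  also have "A \<inter> {b..<1} \<union> A \<inter> {0..<b} = A"
    using A(2) b by auto
  finally show "emeasure (distr unit_interval unit_interval (\<lambda>\<theta>. frac (\<theta> + a))) A =
      emeasure unit_interval A"
    using A by (simp add: emeasure_unit_interval)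
qed simp

section \<open>From distance solutions to label solutions\<close>

lemma label_ip_labelling:
  fixes l :: "'a \<Rightarrow> label"
  assumes "\<And>v. l v \<in> labels k"
    and "\<And>i. i \<in> {1..k} \<Longrightarrow> l (s i) i = 1"
    and "\<And>i j. i \<in> {1..k} \<Longrightarrow> j \<in> {1..k} \<Longrightarrow> (s i, s j) \<in> arcs_ends H \<Longrightarrow> l (s j) i = 0"
  shows "label_ip G H k s
    (\<lambda>v \<sigma>. of_bool (l v = \<sigma>),
     \<lambda>e \<sigma>\<^sub>1 \<sigma>\<^sub>2. of_bool (l (tail G e) = \<sigma>\<^sub>1 \<and> l (head G e) = \<sigma>\<^sub>2),
     \<lambda>e. of_bool (\<not> label_le k (l (tail G e)) (l (head G e))))"
proof -
  interpret prob_space unit_interval by (rule prob_space_unit_interval)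
  have prob_const: "\<P>(\<omega> in unit_interval. P) = of_bool P" for P
    using prob_space by (cases P) (simp_all del: space_unit_interval)
  have "label_lp G H k s (coupling_vars unit_interval G k (\<lambda>v _. l v) (\<lambda>_ \<omega>. \<omega>))"
    using assms by (intro label_lp_coupling_vars) (simp_all add: distr_id2)
  then show ?thesis
    by (simp add: coupling_vars_def prob_const del: label_lp.simps space_unit_interval)
qed

lemma count_space_labels: "count_space (labels k) = Pi\<^sub>M {1..k} (\<lambda>_. count_space {0, 1})"
  unfolding labels_def by (rule count_space_PiM_finite[symmetric]) auto

context directed_multicut
begin

definition ball_label :: "('b \<Rightarrow> real) \<Rightarrow> 'a \<Rightarrow> real \<Rightarrow> label" where
  "ball_label x v \<theta> = (\<lambda>i\<in>{1..k}. if G.\<mu> x (s i) v \<le> \<theta> then 1 else 0)"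

lemma ball_label_in_labels: "ball_label x v \<theta> \<in> labels k"
  by (auto simp: ball_label_def labels_def)

lemma measurable_ball_label: "ball_label x v \<in> measurable borel (count_space (labels k))"
  unfolding count_space_labels ball_label_def[abs_def] by measurable

lemma ball_label_source:
  assumes "i \<in> {1..k}" "0 \<le> \<theta>"
  shows "ball_label x (s i) \<theta> i = 1"
proof -
  have "G.awalk (s i) [] (s i)"
    using terminal_in_verts[OF assms(1)] by (simp add: G.awalk_Nil_iff)
  then have "G.\<mu> x (s i) (s i) \<le> 0"
    using G.min_cost_le_walk_cost[of "s i" "[]" "s i" x] by (simp add: zero_ereal_def)
  also have "0 \<le> ereal \<theta>" using assms(2) by simp
  finally show ?thesis using assms(1) by (simp add: ball_label_def)
qed

lemma ball_label_demand:
  assumes "distance_lp G H x" "i \<in> {1..k}" "(s i, s j) \<in> arcs_ends H" "\<theta> < 1"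
  shows "ball_label x (s j) \<theta> i = 0"
proof -
  have "ereal \<theta> < 1" using assms(4) by simp
  also have "1 \<le> G.\<mu> x (s i) (s j)" using assms(1,3) by (auto simp: G.distance_lp_iff_\<mu>)
  finally show ?thesis using assms(2) by (simp add: ball_label_def not_le)
qed

lemma ball_label_mono:
  assumes lp: "distance_lp G H x" and e: "e \<in> arcs G" and "\<theta> + x e \<le> \<theta>'"
  shows "label_le k (ball_label x (tail G e) \<theta>) (ball_label x (head G e) \<theta>')"
proof -
  have "G.\<mu> x (s i) (head G e) \<le> \<theta>'" if "G.\<mu> x (s i) (tail G e) \<le> \<theta>" for i
  proof -
    have "G.\<mu> x (s i) (head G e) \<le> G.\<mu> x (s i) (tail G e) + x e"
      using lp e by (intro G.pos_cost_mu_triangle) (auto simp: distance_lp_def arc_to_ends_def)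
    also have "\<dots> \<le> ereal \<theta> + x e" using that by (intro add_right_mono)
    also have "\<dots> \<le> \<theta>'" using assms(3) by simp
    finally show ?thesis .
  qed
  then show ?thesis by (auto simp: label_le_def ball_label_def)
qed

lemma prob_ball_label_violation_le:
  assumes lp: "distance_lp G H x" and e: "e \<in> arcs G"
  shows "\<P>(\<theta> in unit_interval. \<not> label_le k (ball_label x (tail G e) \<theta>)
      (ball_label x (head G e) (frac (\<theta> + x e)))) \<le> x e"
    (is "measure _ {\<theta> \<in> _. ?violated \<theta>} \<le> _")
proof -
  interpret prob_space unit_interval by (rule prob_space_unit_interval)
  show ?thesis
  proof (cases "x e < 1")
    case False
    have "prob {\<theta> \<in> space unit_interval. ?violated \<theta>} \<le> 1" by (rule prob_le_1)
    with False show ?thesis by linarith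
  next
    case True
    have nonneg: "0 \<le> x e" using lp e by (simp add: distance_lp_def)
    have "1 - x e \<le> \<theta>" if "\<theta> \<in> {0..<1}" "?violated \<theta>" for \<theta>
    proof (rule ccontr)
      assume "\<not> 1 - x e \<le> \<theta>"
      then have "frac (\<theta> + x e) = \<theta> + x e" using that nonneg by (simp add: frac_eq)
      then show False using that(2) ball_label_mono[OF lp e, of \<theta>] by simp
    qed
    then have "{\<theta> \<in> space unit_interval. ?violated \<theta>} \<subseteq> {1 - x e..<1}" by auto
    moreover have "{1 - x e..<1} \<in> events"
      using True by (simp add: unit_interval_def sets_restrict_space_iff)
    ultimately have "prob {\<theta> \<in> space unit_interval. ?violated \<theta>} \<le> prob {1 - x e..<1}"
      by (rule finite_measure_mono)
    also have "\<dots> = x e"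
      using True nonneg by (simp add: measure_def emeasure_unit_interval)
    finally show ?thesis .
  qed
qed

lemma distance_lp_imp_ex_label_lp_cost_le:
  assumes lp: "distance_lp G H x"
  shows "\<exists>z. label_lp G H k s z \<and> label_cost G w z \<le> cost G w x"
proof (intro exI conjI)
  interpret prob_space unit_interval by (rule prob_space_unit_interval)
  let ?z = "coupling_vars unit_interval G k (ball_label x) (\<lambda>e \<theta>. frac (\<theta> + x e))"
  show "label_lp G H k s ?z"
    using lp ball_label_source ball_label_demand
    by (intro label_lp_coupling_vars measurable_unit_intervalI measurable_ball_label
        measurable_frac_add distr_frac_add) simp_all
  show "label_cost G w ?z \<le> cost G w x"
    unfolding coupling_vars_def label_cost.simps
    by (intro cost_mono prob_ball_label_violation_le[OF lp])
qed

lemma distance_ip_imp_ex_label_ip_cost_le: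
  assumes ip: "distance_ip G H x"
  shows "\<exists>z. label_ip G H k s z \<and> label_cost G w z \<le> cost G w x"
proof -
  have lp: "distance_lp G H x" using ip by (simp add: distance_ip_def)
  define x' :: "'b \<Rightarrow> real"
    where "x' e = of_bool (\<not> label_le k (ball_label x (tail G e) 0) (ball_label x (head G e) 0))" for e
  obtain zv ze where "label_ip G H k s (zv, ze, x')"
    using label_ip_labelling[of "\<lambda>v. ball_label x v 0" k s H G]
      ball_label_in_labels ball_label_source ball_label_demand[OF lp]
    unfolding x'_def[abs_def] by (simp del: label_ip.simps)
  moreover have "x' e \<le> x e" if e: "e \<in> arcs G" for e
    using ip e ball_label_mono[OF lp e, of 0 0] by (auto simp: distance_ip_def x'_def)
  then have "cost G w x' \<le> cost G w x" by (rule cost_mono)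
  ultimately show ?thesis by (metis label_cost.simps)
qed

end

theorem theorem7:
  fixes G :: "('a, 'b) pre_digraph" and H :: "('a, 'c) pre_digraph"
    and w :: "'b \<Rightarrow> real" and k :: nat and s :: "nat \<Rightarrow> 'a"
  assumes "directed_multicut G H w k s"
  shows "(\<exists>m. is_opt_value (label_lp G H k s) (label_cost G w) m \<and>
              is_opt_value (distance_lp G H) (cost G w) m) \<and>
         (\<exists>m. is_opt_value (label_ip G H k s) (label_cost G w) m \<and>
              is_opt_value (distance_ip G H) (cost G w) m)"
proof -
  interpret directed_multicut G H w k s by (rule assms)
  have "is_opt_value (label_lp G H k s) (label_cost G w) m"
    if "is_opt_value (distance_lp G H) (cost G w) m" for m
    using that
  proof (rule is_opt_value_transfer)
    show "\<exists>x. distance_lp G H x \<and> cost G w x \<le> label_cost G w z" if "label_lp G H k s z" for z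
      using that label_lp_imp_distance_lp by (cases z) (auto simp del: label_lp.simps)
  qed (rule distance_lp_imp_ex_label_lp_cost_le)
  moreover have "is_opt_value (label_ip G H k s) (label_cost G w) m"
    if "is_opt_value (distance_ip G H) (cost G w) m" for m
    using that
  proof (rule is_opt_value_transfer)
    show "\<exists>x. distance_ip G H x \<and> cost G w x \<le> label_cost G w z" if "label_ip G H k s z" for z
      using that label_ip_imp_distance_ip by (cases z) (auto simp del: label_ip.simps)
  qed (rule distance_ip_imp_ex_label_ip_cost_le)
  ultimately show ?thesis
    using ex_opt_value_distance_lp ex_opt_value_distance_ip by blast
qed

end
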